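(* Let $C$ be a 2-copula. Then $C$ is stochastically increasing in the first component if and only if $$(D*C)(u,v)\le C(u,v)$$ holds for all 2-copulas $D$ and all $u,v\in[0,1]$. Moreover, $C$ is stochastically decreasing in the first component if and only if $$C(u,v)\le (D*C)(u,v)$$ holds for all 2-copulas $D$ and all $u,v\in[0,1]$.
   Context: A 2-copula is a bivariate distribution function on $[0,1]^2$ with uniform margins. The Markov product of 2-copulas $C_1,C_2$ is the 2-copula $(C_1*C_2)(u,v)=\int_0^1\partial_2C_1(u,t)\,\partial_1C_2(t,v)\,\mathrm{d}t$, where partial derivatives exist almost everywhere. A 2-copula $C$ is stochastically increasing (decreasing) in the first component if, for every $v\in[0,1]$, the function $u\mapsto\partial_1C(u,v)$ is (non-strictly) decreasing (increasing) for almost all $u\in[0,1]$, i.e. agrees almost everywhere with a decreasing (increasing) function; equivalently, $u\mapsto C(u,v)$ is concave (convex) for every $v\in[0,1]$. *)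

theory Defs
  imports "HOL-Probability.Probability"
begin

text \<open>Copulas are functions on $[0,1]^2$. They are represented as total curried functions whose
  values outside the unit square are irrelevant: nothing below depends on them, except for
  derivatives at the endpoints 0 and 1, which form a null set. The margin conditions already
  force the measure to be concentrated on the unit square.\<close>

definition copula2 :: "(real \<Rightarrow> real \<Rightarrow> real) \<Rightarrow> bool" where
  "copula2 C \<longleftrightarrow>
     (\<exists>M :: (real \<times> real) measure.
        prob_space M \<and> sets M = sets borel \<and>
        distr M borel fst = uniform_measure lborel {0..1} \<and>
        distr M borel snd = uniform_measure lborel {0..1} \<and>
        (\<forall>u\<in>{0..1}. \<forall>v\<in>{0..1}. C u v = measure M ({..u} \<times> {..v})))"

text \<open>The partial derivatives of a copula exist only almost everywhere; \<^const>\<open>deriv\<close> takes an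
  unspecified value elsewhere. Hence they are only ever used up to null sets (and with respect to
  the complete measure \<^const>\<open>lebesgue\<close>).\<close>

definition partial1 :: "(real \<Rightarrow> real \<Rightarrow> real) \<Rightarrow> real \<Rightarrow> real \<Rightarrow> real" where
  "partial1 C u v = deriv (\<lambda>s. C s v) u"

definition partial2 :: "(real \<Rightarrow> real \<Rightarrow> real) \<Rightarrow> real \<Rightarrow> real \<Rightarrow> real" where
  "partial2 C u v = deriv (\<lambda>t. C u t) v"

definition markov_product ::
    "(real \<Rightarrow> real \<Rightarrow> real) \<Rightarrow> (real \<Rightarrow> real \<Rightarrow> real) \<Rightarrow> real \<Rightarrow> real \<Rightarrow> real" where
  "markov_product C1 C2 u v =
     set_lebesgue_integral lebesgue {0..1} (\<lambda>t. partial2 C1 u t * partial1 C2 t v)"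

text \<open>Note the reversal: stochastically \<^emph>\<open>increasing\<close> means that the partial derivative
  $u \mapsto \partial_1 C(u,v)$, the conditional probability of $V \le v$ given $U = u$, is
  \<^emph>\<open>decreasing\<close>.\<close>

definition stoch_increasing1 :: "(real \<Rightarrow> real \<Rightarrow> real) \<Rightarrow> bool" where
  "stoch_increasing1 C \<longleftrightarrow>
     (\<forall>v\<in>{0..1}. \<exists>g :: real \<Rightarrow> real. antimono_on {0..1} g \<and>
        (AE u in lebesgue. u \<in> {0..1} \<longrightarrow> partial1 C u v = g u))"

definition stoch_decreasing1 :: "(real \<Rightarrow> real \<Rightarrow> real) \<Rightarrow> bool" where
  "stoch_decreasing1 C \<longleftrightarrow>
     (\<forall>v\<in>{0..1}. \<exists>g :: real \<Rightarrow> real. mono_on {0..1} g \<and>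
        (AE u in lebesgue. u \<in> {0..1} \<longrightarrow> partial1 C u v = g u))"

end

theory Submission
  imports Defs
begin

text \<open>Fix $v$ and put $c(t) = C(t,v)$. Everything reduces to statements about the function $c$ once it
  is known that $c$ is the integral of its own derivative and that the same holds for
  $t \mapsto D(u,t)$: then with $f = c'$ and $d = \partial_2 D(u,\cdot)$ one has
  $(D*C)(u,v) = \int_0^1 d\,f$ and $C(u,v) = \int_0^u f$, where $0 \le d \le 1$ and
  $\int_0^1 d = D(u,1) = u$.

  If $f$ is decreasing, then among all weights $0 \le d \le 1$ of total mass $u$ the integral
  $\int d\,f$ is largest for $d = 1_{[0,u]}$, which puts all its mass where $f$ is largest
  (\<open>integral_mult_le_of_antimono\<close>). This is one direction.

  The converse needs only very few copulas $D$: the joint distributions of $(U, TU)$, where $U$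
  is uniform and $T$ reflects a subinterval $[a,b]$ and fixes all other points. For $u \in [a,b]$ it
  gives $(D*C)(u,v) = c(a) + c(b) - c(a+b-u)$ (\<open>markov_product_reflection\<close>), so the hypothesis
  becomes the concavity inequality $c(a) + c(b) \le c(u) + c(a+b-u)$. Shrinking the intervals
  $[a,u]$ and $[a+b-u,b]$ to two points of differentiability shows that $c'$ is decreasing where
  it exists (\<open>derivative_antimono_of_four_point\<close>), and a bounded decreasing function on a set of full measure
  extends to a decreasing function. The stochastically decreasing case is the same
  argument for $-c$.

  The analytic input is the Lebesgue differentiation theorem on the line, proved here from the
  Vitali covering theorem; the density $f$ itself is a Radon--Nikodym derivative.\<close>

section \<open>Lebesgue differentiation on the line\<close>

text \<open>Since $A$ is a null set of the measure, outer regularity gives an open $U \supseteq A$ of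
  arbitrarily small measure. The balls inside $U$ on which the measure is at least $e$ times the radius form a Vitali
  cover of the exceptional set, and disjoint such balls have total length at most
  $2/e$ times the measure of $U$.\<close>
lemma negligible_positive_upper_density:
  fixes N :: "real measure" and A :: "real set"
  assumes fin: "finite_measure N" and N [measurable_cong]: "sets N = sets borel"
    and A: "A \<in> sets borel" and NA: "emeasure N A = 0" and e: "e > 0"
  shows "negligible {x\<in>A. \<forall>d>0. \<exists>r. 0 < r \<and> r < d \<and> e * r \<le> measure N (cball x r)}"
    (is "negligible ?S")
  unfolding negligible_outer_le
proof (intro allI impI)
  interpret finite_measure N by (rule fin)
  fix \<delta> :: real assume \<delta>: "\<delta> > 0"
  have "emeasure N (space N) \<noteq> \<infinity>" by simp
  then have "(INF U \<in> {U. A \<subseteq> U \<and> open U}. emeasure N U) = 0"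
    using outer_regular[OF N] A NA by simp
  moreover have pos: "0 < ennreal (e * \<delta> / 2)" using e \<delta> by simp
  ultimately obtain U where U: "A \<subseteq> U" "open U" "emeasure N U < ennreal (e * \<delta> / 2)"
    by (metis (no_types, lifting) INF_less_iff mem_Collect_eq)
  have [measurable]: "U \<in> sets borel" using U by simp
  define K where "K = {(x, r). 0 < r \<and> cball x r \<subseteq> U \<and> e * r \<le> measure N (cball x r)}"
  have cover: "\<exists>i. i \<in> K \<and> x \<in> cball (fst i) (snd i) \<and> snd i < d" if "x \<in> ?S" "0 < d" for x d
  proof -
    have xU: "x \<in> U" and dens: "\<And>d. d > 0 \<Longrightarrow> \<exists>r. 0 < r \<and> r < d \<and> e * r \<le> measure N (cball x r)"
      using that(1) U(1) by auto
    obtain k where k: "k > 0" "cball x k \<subseteq> U"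
      using open_contains_cball_eq[OF U(2)] xU by blast
    have "min d k > 0" using k that(2) by simp
    then obtain r where r: "0 < r" "r < min d k" "e * r \<le> measure N (cball x r)"
      using dens by blast
    have "cball x r \<subseteq> cball x k" using r by (intro subset_cball) simp
    then have "cball x r \<subseteq> U" using k by blast
    then show ?thesis using r by (intro exI[of _ "(x, r)"]) (auto simp: K_def)
  qed
  have Kpos: "0 < snd i" if "i \<in> K" for i using that by (auto simp: K_def)
  obtain C where C: "countable C" "C \<subseteq> K"
    "pairwise (\<lambda>i j. disjnt (cball (fst i) (snd i)) (cball (fst j) (snd j))) C"
    "negligible (?S - (\<Union>i\<in>C. cball (fst i) (snd i)))"
    by (rule Vitali_covering_theorem_cballs[of K snd ?S fst, OF Kpos cover])
  let ?B = "\<lambda>i::real \<times> real. cball (fst i) (snd i)"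
  let ?W = "\<Union>i\<in>C. ?B i"
  have disj: "disjoint_family_on ?B C"
    using C(3) by (auto simp: disjoint_family_on_def pairwise_def disjnt_def)
  have Wb [measurable]: "?W \<in> sets borel" using C(1) by (intro sets.countable_UN') auto
  have "emeasure lborel ?W = (\<integral>\<^sup>+i. emeasure lborel (?B i) \<partial>count_space C)"
    using C(1) disj by (intro emeasure_UN_countable) auto
  also have "\<dots> \<le> (\<integral>\<^sup>+i. ennreal (2 / e) * emeasure N (?B i) \<partial>count_space C)"
  proof (intro nn_integral_mono)
    fix i assume "i \<in> space (count_space C)"
    then have i: "0 < snd i" "e * snd i \<le> measure N (?B i)" using C(2) by (auto simp: K_def)
    have "emeasure lborel (?B i) = ennreal (2 * snd i)"
      using i(1) by (simp add: cball_eq_atLeastAtMost)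
    also have "\<dots> \<le> ennreal (2 / e * measure N (?B i))"
      using i e by (intro ennreal_leI) (simp add: field_simps)
    also have "\<dots> = ennreal (2 / e) * emeasure N (?B i)"
      using e by (simp add: emeasure_eq_measure flip: ennreal_mult)
    finally show "emeasure lborel (?B i) \<le> ennreal (2 / e) * emeasure N (?B i)" .
  qed
  also have "\<dots> = ennreal (2 / e) * (\<integral>\<^sup>+i. emeasure N (?B i) \<partial>count_space C)"
    by (intro nn_integral_cmult) auto
  also have "(\<integral>\<^sup>+i. emeasure N (?B i) \<partial>count_space C) = emeasure N ?W"
    using C(1) disj by (intro emeasure_UN_countable[symmetric]) (auto simp: N)
  also have "\<dots> \<le> emeasure N U"
  proof (rule emeasure_mono)
    have "?B i \<subseteq> U" if "i \<in> C" for i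
      using subsetD[OF C(2) that] unfolding K_def by (simp add: case_prod_beta)
    then show "?W \<subseteq> U" by blast
  qed (simp add: N U(2))
  also have "\<dots> \<le> ennreal (e * \<delta> / 2)" using U by simp
  also have "ennreal (2 / e) * ennreal (e * \<delta> / 2) = ennreal \<delta>"
    using e \<delta> by (simp flip: ennreal_mult)
  finally have W: "emeasure lborel ?W \<le> ennreal \<delta>" by (simp add: mult_left_mono)
  then have Wf: "?W \<in> lmeasurable" "measure lebesgue ?W \<le> \<delta>"
    subgoal using Wb by (auto simp: fmeasurable_def le_less_trans)
    subgoal using W \<delta> Wb by (auto simp: measure_def intro!: enn2real_leI)
    done
  let ?Z = "?S - ?W"
  show "\<exists>T. ?S \<subseteq> T \<and> T \<in> lmeasurable \<and> measure lebesgue T \<le> \<delta>"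
  proof (intro exI conjI)
    show "?S \<subseteq> ?W \<union> ?Z" by blast
    show "?W \<union> ?Z \<in> lmeasurable"
      by (rule fmeasurable.Un[OF Wf(1) negligible_imp_measurable[OF C(4)]])
    have "measure lebesgue (?W \<union> ?Z) \<le> measure lebesgue ?W + measure lebesgue ?Z"
      by (rule measure_Un_le[OF fmeasurableD[OF Wf(1)] fmeasurableD[OF negligible_imp_measurable[OF C(4)]]])
    also have "measure lebesgue ?Z = 0" using C(4) by (rule negligible_imp_measure0)
    finally show "measure lebesgue (?W \<union> ?Z) \<le> \<delta>" using Wf by linarith
  qed
qed

text \<open>Split $f \le r + (f - r)^+$. On $\{f \le r\}$ the measure with density $(f-r)^+$ vanishes, so the
  preceding lemma bounds its mass near almost every point of that set by $q - r$ times the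
  length. The density is cut off to $(-n,n)$ because for $r < 0$ it is in general not integrable.\<close>
lemma AE_upper_derivative_le:
  fixes f :: "real \<Rightarrow> real"
  assumes f: "integrable lborel f" and rq: "r < q"
  shows "AE x in lebesgue. f x \<le> r \<longrightarrow> (\<exists>d>0. \<forall>y. y \<noteq> x \<longrightarrow> \<bar>y - x\<bar> < d \<longrightarrow>
     ((LINT s:{..y}|lborel. f s) - (LINT s:{..x}|lborel. f s)) / (y - x) \<le> q)"
proof -
  let ?F = "\<lambda>t. LINT s:{..t}|lborel. f s"
  have [measurable]: "f \<in> borel_measurable borel" using f by auto
  have "AE x in lebesgue. x \<in> {- real n<..<real n} \<and> f x \<le> r \<longrightarrow> (\<exists>d>0. \<forall>y. y \<noteq> x \<longrightarrow> \<bar>y - x\<bar> < d \<longrightarrow>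
     (?F y - ?F x) / (y - x) \<le> q)" for n
  proof -
    define J where "J = {- real n<..<real n}"
    define k where "k = (\<lambda>s. indicator J s * max 0 (f s - r))"
    have [measurable]: "J \<in> sets borel" by (simp add: J_def)
    have kint: "integrable lborel k"
    proof (rule Bochner_Integration.integrable_bound)
      show "integrable lborel (\<lambda>s. \<bar>f s\<bar> + \<bar>r\<bar> * indicator J s)"
        using f by (auto simp: J_def)
      show "k \<in> borel_measurable lborel" unfolding k_def by measurable
      show "AE s in lborel. norm (k s) \<le> norm (\<bar>f s\<bar> + \<bar>r\<bar> * indicator J s)"
        by (auto simp: k_def split: split_indicator)
    qed
    have kpos: "0 \<le> k s" for s by (simp add: k_def)
    have [measurable]: "k \<in> borel_measurable borel" using kint by auto
    define N where "N = density lborel (\<lambda>s. ennreal (k s))"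
    have N: "sets N = sets borel" by (simp add: N_def)
    have measN: "emeasure N B = ennreal (LINT s:B|lborel. k s)" if "B \<in> sets borel" for B
    proof -
      have "emeasure N B = (\<integral>\<^sup>+s. ennreal (indicator B s * k s) \<partial>lborel)"
        using that by (auto simp: N_def emeasure_density intro!: nn_integral_cong split: split_indicator)
      also have "\<dots> = ennreal (LINT s|lborel. indicator B s * k s)"
        using that kint kpos
        by (intro nn_integral_eq_integral) (auto intro: integrable_real_mult_indicator simp: mult.commute)
      finally show ?thesis by (simp add: set_lebesgue_integral_def)
    qed
    have fin: "finite_measure N"
      using measN[of UNIV] by (intro finite_measureI) (auto simp: N_def)
    define A where "A = {x\<in>J. f x \<le> r}"
    have A: "A \<in> sets borel" unfolding A_def by measurable
    have "(LINT s:A|lborel. k s) = 0"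
      unfolding set_lebesgue_integral_def
      by (intro integral_eq_zero_AE) (auto simp: A_def k_def split: split_indicator)
    then have NA: "emeasure N A = 0" using measN[OF A] by simp
    have "negligible {x\<in>A. \<forall>d>0. \<exists>\<rho>. 0 < \<rho> \<and> \<rho> < d \<and> (q - r) * \<rho> \<le> measure N (cball x \<rho>)}"
      using rq by (intro negligible_positive_upper_density fin N A NA) simp
    then have "AE x in lebesgue. \<not> (x \<in> A \<and> (\<forall>d>0. \<exists>\<rho>. 0 < \<rho> \<and> \<rho> < d \<and> (q - r) * \<rho> \<le> measure N (cball x \<rho>)))"
      by (intro AE_I'[where N = "{x\<in>A. \<forall>d>0. \<exists>\<rho>. 0 < \<rho> \<and> \<rho> < d \<and> (q - r) * \<rho> \<le> measure N (cball x \<rho>)}"])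
        (auto simp: negligible_iff_null_sets)
    then show ?thesis
    proof eventually_elim
      case (elim x)
      show ?case
      proof
        assume x: "x \<in> {- real n<..<real n} \<and> f x \<le> r"
        then have "x \<in> A" by (simp add: A_def J_def)
        then obtain d where d: "d > 0" "\<And>\<rho>. 0 < \<rho> \<Longrightarrow> \<rho> < d \<Longrightarrow> measure N (cball x \<rho>) < (q - r) * \<rho>"
          using elim by force
        \<comment> \<open>Small enough for the ball around $x$ to stay inside the cut-off interval.\<close>
        define d' where "d' = min d (min (x + real n) (real n - x))"
        have incr: "?F w - ?F u \<le> q * (w - u)" if uw: "u < w" "w - u < d'" "u = x \<or> w = x" for u w
        proof -
          define \<rho> where "\<rho> = w - u"
          have \<rho>: "0 < \<rho>" "\<rho> < d'" using uw by (auto simp: \<rho>_def)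
          have sub: "{u<..w} \<subseteq> cball x \<rho>" "cball x \<rho> \<subseteq> J"
            using uw \<rho> by (auto simp: cball_eq_atLeastAtMost \<rho>_def J_def d'_def)
          have si: "set_integrable lborel B f" "set_integrable lborel B k" if "B \<in> sets borel" for B
            using f kint that unfolding set_integrable_def by (auto intro!: integrable_mult_indicator simp del: real_scaleR_def)
          have ii: "integrable lborel (indicator {u<..w} :: real \<Rightarrow> real)"
            using uw by (intro integrable_real_indicator) auto
          have "{..w} = {..u} \<union> {u<..w}" using uw by auto
          then have "?F w = ?F u + (LINT s:{u<..w}|lborel. f s)"
            by (simp only:) (intro set_integral_Un si; auto)
          also have "(LINT s:{u<..w}|lborel. f s) \<le> (LINT s:{u<..w}|lborel. r + k s)"
          proof (rule set_integral_mono)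
            show "set_integrable lborel {u<..w} (\<lambda>s. r + k s)"
              by (intro set_integral_add si) (use ii in \<open>auto simp: set_integrable_def\<close>)
            show "f s \<le> r + k s" if "s \<in> {u<..w}" for s
            proof -
              have "s \<in> J" using that sub by blast
              then show ?thesis by (simp add: k_def)
            qed
          qed (intro si; simp)
          also have "\<dots> = r * \<rho> + (LINT s:{u<..w}|lborel. k s)"
            using uw ii si(2)[of "{u<..w}"]
            by (subst set_integral_add) (auto simp: set_integrable_def set_lebesgue_integral_def \<rho>_def)
          also have "(LINT s:{u<..w}|lborel. k s) \<le> (LINT s:cball x \<rho>|lborel. k s)"
            unfolding set_lebesgue_integral_def
          proof (rule integral_mono)
            show "indicator {u<..w} s *\<^sub>R k s \<le> indicator (cball x \<rho>) s *\<^sub>R k s" for s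
              using sub(1) kpos[of s] by (auto split: split_indicator)
          qed (use si[unfolded set_integrable_def] in auto)
          also have "\<dots> = measure N (cball x \<rho>)"
            using measN[of "cball x \<rho>"] kpos
            by (simp add: measure_def set_lebesgue_integral_def integral_nonneg_AE)
          also have "\<dots> \<le> (q - r) * \<rho>" using d(2)[of \<rho>] \<rho> by (auto simp: d'_def)
          finally show ?thesis by (simp add: \<rho>_def algebra_simps)
        qed
        show "\<exists>d>0. \<forall>y. y \<noteq> x \<longrightarrow> \<bar>y - x\<bar> < d \<longrightarrow> (?F y - ?F x) / (y - x) \<le> q"
        proof (intro exI[of _ d'] conjI allI impI)
          show "0 < d'" using d x by (simp add: d'_def)
          fix y assume y: "y \<noteq> x" "\<bar>y - x\<bar> < d'"
          show "(?F y - ?F x) / (y - x) \<le> q"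
            using incr[of x y] incr[of y x] y
            by (cases "x < y") (auto simp: field_simps abs_if)
        qed
      qed
    qed
  qed
  then have "AE x in lebesgue. \<forall>n. x \<in> {- real n<..<real n} \<and> f x \<le> r \<longrightarrow> (\<exists>d>0. \<forall>y. y \<noteq> x \<longrightarrow> \<bar>y - x\<bar> < d \<longrightarrow>
     (?F y - ?F x) / (y - x) \<le> q)"
    by (subst AE_all_countable) blast
  then show ?thesis
  proof eventually_elim
    case (elim x)
    obtain n where "\<bar>x\<bar> < real n" using reals_Archimedean2 by blast
    then show ?case using elim[rule_format, of n] by (auto simp: abs_less_iff)
  qed
qed

text \<open>The one-sided bound, applied to $f$ and to $-f$ with all rational thresholds.\<close>
theorem lebesgue_differentiation:
  fixes f :: "real \<Rightarrow> real"
  assumes f: "integrable lborel f"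
  shows "AE x in lebesgue. ((\<lambda>t. LINT s:{..t}|lborel. f s) has_real_derivative f x) (at x)"
proof -
  define F where "F = (\<lambda>t. LINT s:{..t}|lborel. f s)"
  have up: "AE x in lebesgue. \<forall>r\<in>\<rat>. \<forall>q\<in>\<rat>. r < q \<longrightarrow> g x \<le> r \<longrightarrow> (\<exists>d>0. \<forall>y. y \<noteq> x \<longrightarrow> \<bar>y - x\<bar> < d \<longrightarrow>
     ((LINT s:{..y}|lborel. g s) - (LINT s:{..x}|lborel. g s)) / (y - x) \<le> q)"
    if "integrable lborel g" for g :: "real \<Rightarrow> real"
    using AE_upper_derivative_le[OF that]
    by (subst AE_ball_countable[OF countable_rat], intro ballI)+ auto
  have neg: "(LINT s:{..y}|lborel. - f s) = - F y" for y
    by (simp add: F_def set_lebesgue_integral_def)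
  show ?thesis
    using up[OF f] up[OF integrable_minus[OF f]]
  proof eventually_elim
    case (elim x)
    have upper: "\<exists>d>0. \<forall>y. y \<noteq> x \<longrightarrow> \<bar>y - x\<bar> < d \<longrightarrow> (F y - F x) / (y - x) < f x + e" if "e > 0" for e
    proof -
      have "f x < f x + e / 2" using that by simp
      then obtain r where r: "r \<in> \<rat>" "f x < r" "r < f x + e / 2" using Rats_dense_in_real by blast
      have "r < f x + e" using r that by simp
      then obtain q where q: "q \<in> \<rat>" "r < q" "q < f x + e" using Rats_dense_in_real by blast
      obtain d where d: "d > 0" "\<And>y. y \<noteq> x \<Longrightarrow> \<bar>y - x\<bar> < d \<Longrightarrow> (F y - F x) / (y - x) \<le> q"
        using elim(1)[rule_format, of r q] r q unfolding F_def by auto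
      then show ?thesis using q(3) by (meson le_less_trans)
    qed
    have lower: "\<exists>d>0. \<forall>y. y \<noteq> x \<longrightarrow> \<bar>y - x\<bar> < d \<longrightarrow> f x - e < (F y - F x) / (y - x)" if "e > 0" for e
    proof -
      have "- f x < - f x + e / 2" using that by simp
      then obtain r where r: "r \<in> \<rat>" "- f x < r" "r < - f x + e / 2" using Rats_dense_in_real by blast
      have "r < - f x + e" using r that by simp
      then obtain q where q: "q \<in> \<rat>" "r < q" "q < - f x + e" using Rats_dense_in_real by blast
      obtain d where d: "d > 0" "\<And>y. y \<noteq> x \<Longrightarrow> \<bar>y - x\<bar> < d \<Longrightarrow> (- F y - - F x) / (y - x) \<le> q"
        using elim(2)[rule_format, of r q] r q unfolding neg by auto
      have "f x - e < (F y - F x) / (y - x)" if "y \<noteq> x" "\<bar>y - x\<bar> < d" for y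
      proof -
        have "(- F y - - F x) / (y - x) = - ((F y - F x) / (y - x))" by (simp add: minus_divide_left)
        then show ?thesis using d(2)[OF that] q by linarith
      qed
      then show ?thesis using d(1) by blast
    qed
    have "((\<lambda>y. (F y - F x) / (y - x)) \<longlongrightarrow> f x) (at x)"
    proof (rule order_tendstoI)
      fix a assume "a < f x"
      then show "\<forall>\<^sub>F y in at x. a < (F y - F x) / (y - x)"
        using lower[of "f x - a"] by (auto simp: eventually_at dist_real_def)
    next
      fix a assume "f x < a"
      then show "\<forall>\<^sub>F y in at x. (F y - F x) / (y - x) < a"
        using upper[of "a - f x"] by (auto simp: eventually_at dist_real_def)
    qed
    then show ?case unfolding F_def[symmetric] by (simp add: has_field_derivative_iff)
  qed
qed

section \<open>Sections of a copula\<close>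

text \<open>Partial derivatives are specified only almost everywhere; completeness of Lebesgue measure is
  what makes them measurable nevertheless, and hence replaceable under the integral.\<close>
lemma borel_measurable_lebesgue_cong_AE:
  fixes f g :: "real \<Rightarrow> real"
  assumes [measurable]: "f \<in> borel_measurable lebesgue" and eq: "AE x in lebesgue. f x = g x"
  shows "g \<in> borel_measurable lebesgue"
proof (rule measurableI)
  fix B :: "real set" assume B [measurable]: "B \<in> sets borel"
  have "AE x in lebesgue. (x \<in> f -` B \<inter> space lebesgue) \<longleftrightarrow> (x \<in> g -` B \<inter> space lebesgue)"
    using eq by eventually_elim auto
  then show "g -` B \<inter> space lebesgue \<in> sets lebesgue"
    by (rule completion.in_sets_AE) (use measurable_sets[OF assms(1) B] in auto)
qed auto

text \<open>The endpoints are null and excluded, because there the values of $c$ outside the unit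
  interval would enter the derivative.\<close>
lemma AE_has_derivative_of_density:
  fixes f c :: "real \<Rightarrow> real"
  assumes f: "integrable lborel f"
    and c: "\<And>u. u \<in> {0..1} \<Longrightarrow> c u = (LINT s:{0..u}|lborel. f s)"
  shows "AE t in lebesgue. t \<in> {0..1} \<longrightarrow> t \<in> {0<..<1} \<and> (c has_real_derivative f t) (at t)"
proof -
  define g where "g = (\<lambda>t. indicator {0..1} t * f t)"
  have g: "integrable lborel g"
    using integrable_mult_indicator[of "{0..1::real}", OF _ f] by (simp add: g_def)
  have ends: "AE t in lebesgue. t \<noteq> (0::real) \<and> t \<noteq> 1"
    using AE_lborel_singleton[of "0::real"] AE_lborel_singleton[of "1::real"]
    by (intro AE_completion) auto
  have eq: "(LINT s:{..t}|lborel. g s) = c t" if "t \<in> {0<..<1}" for t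
  proof -
    have "(LINT s:{..t}|lborel. g s) = (LINT s:{0..t}|lborel. f s)"
      unfolding set_lebesgue_integral_def g_def
      by (intro Bochner_Integration.integral_cong) (use that in \<open>auto split: split_indicator\<close>)
    then show ?thesis using c that by simp
  qed
  show ?thesis
    using lebesgue_differentiation[OF g] ends
  proof eventually_elim
    case (elim t)
    show ?case
    proof
      assume "t \<in> {0..1}"
      then have t: "t \<in> {0<..<1}" using elim by auto
      have "((\<lambda>t. LINT s:{..t}|lborel. g s) has_real_derivative f t) (at t)"
        using elim(1) t by (simp add: g_def)
      then have "(c has_real_derivative f t) (at t)"
        by (rule has_field_derivative_transform_within_open[where S = "{0<..<1}"]) (use t eq in auto)
      with t show "t \<in> {0<..<1} \<and> (c has_real_derivative f t) (at t)" by simp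
    qed
  qed
qed

text \<open>Turns statements about $\partial_1$ into statements about $\partial_2$.\<close>
lemma copula2_swap:
  assumes "copula2 C"
  shows "copula2 (\<lambda>u v. C v u)"
proof -
  obtain M :: "(real \<times> real) measure" where M: "prob_space M" "sets M = sets borel"
    "distr M borel fst = uniform_measure lborel {0..1}"
    "distr M borel snd = uniform_measure lborel {0..1}"
    "\<And>u v. u \<in> {0..1} \<Longrightarrow> v \<in> {0..1} \<Longrightarrow> C u v = measure M ({..u} \<times> {..v})"
    using assms unfolding copula2_def by blast
  interpret prob_space M by (rule M(1))
  note [measurable_cong] = M(2)
  have swp [measurable]: "prod.swap \<in> M \<rightarrow>\<^sub>M (borel :: (real \<times> real) measure)"
    unfolding prod.swap_def by (simp add: measurable_cong_sets[OF M(2) refl] borel_prod[symmetric])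
  have fst_snd [measurable]: "fst \<in> borel_measurable (borel :: (real \<times> real) measure)"
    "snd \<in> borel_measurable (borel :: (real \<times> real) measure)"
    by (simp_all add: borel_prod[symmetric])
  let ?M = "distr M borel prod.swap"
  show ?thesis
    unfolding copula2_def
  proof (intro exI[of _ ?M] conjI ballI)
    show "prob_space ?M" by (rule prob_space_distr) (rule swp)
    show "distr ?M borel fst = uniform_measure lborel {0..1}"
      using M(4) by (subst distr_distr) (auto simp: comp_def)
    show "distr ?M borel snd = uniform_measure lborel {0..1}"
      using M(3) by (subst distr_distr) (auto simp: comp_def)
    fix u v :: real assume uv: "u \<in> {0..1}" "v \<in> {0..1}"
    have "prod.swap -` ({..u} \<times> {..v}) \<inter> space M = {..v} \<times> {..u}"
      using sets_eq_imp_space_eq[OF M(2)] by auto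
    moreover have "{..u} \<times> {..v} \<in> sets (borel :: (real \<times> real) measure)"
      by (simp add: borel_prod[symmetric])
    ultimately show "C v u = measure ?M ({..u} \<times> {..v})"
      using M(5)[OF uv(2,1)] by (subst measure_distr) auto
  qed simp
qed

text \<open>The measure $N(A) = M(A \times (-\infty, v])$ is dominated by the first margin, that is, by
  Lebesgue measure on $[0,1]$; hence it has a density with values in $[0,1]$.\<close>
lemma copula_section_density:
  assumes "copula2 C" and v: "v \<in> {0..1}"
  obtains f where "integrable lborel f"
    and "\<And>u. u \<in> {0..1} \<Longrightarrow> C u v = (LINT s:{0..u}|lborel. f s)"
    and "AE t in lborel. 0 \<le> f t \<and> f t \<le> 1"
proof -
  obtain M :: "(real \<times> real) measure" where M: "prob_space M" "sets M = sets borel"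
    "distr M borel fst = uniform_measure lborel {0..1}"
    "\<And>u v. u \<in> {0..1} \<Longrightarrow> v \<in> {0..1} \<Longrightarrow> C u v = measure M ({..u} \<times> {..v})"
    using assms unfolding copula2_def by blast
  interpret prob_space M by (rule M(1))
  note [measurable_cong] = M(2)
  have sp: "space M = UNIV" using sets_eq_imp_space_eq[OF M(2)] by simp
  have fs [measurable]: "fst \<in> borel_measurable M" "snd \<in> borel_measurable M"
    by (simp_all add: measurable_cong_sets[OF M(2) refl] borel_prod[symmetric])
  define N where "N = distr (density M (indicator (snd -` {..v}))) borel fst"
  have sv [measurable]: "snd -` {..v} \<in> sets M"
    using measurable_sets[OF fs(2), of "{..v}"] sp by simp
  have N: "emeasure N A = emeasure M (A \<times> {..v})" if [measurable]: "A \<in> sets borel" for A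
  proof -
    have A: "fst -` A \<in> sets M" using measurable_sets[OF fs(1), of A] sp by simp
    have "emeasure N A = emeasure (density M (indicator (snd -` {..v}))) (fst -` A)"
      unfolding N_def by (subst emeasure_distr) (auto simp: sp)
    also have "\<dots> = (\<integral>\<^sup>+x. indicator (A \<times> {..v}) x \<partial>M)"
      using A by (subst emeasure_density) (auto intro!: nn_integral_cong split: split_indicator)
    also have "\<dots> = emeasure M (A \<times> {..v})"
      by (rule nn_integral_indicator) (simp add: M(2) borel_prod[symmetric])
    finally show ?thesis .
  qed
  have NL: "emeasure N A \<le> emeasure lborel ({0..1} \<inter> A)" if [measurable]: "A \<in> sets borel" for A
  proof -
    have A: "fst -` A \<in> sets M" using measurable_sets[OF fs(1), of A] sp by simp
    have "emeasure N A \<le> emeasure M (fst -` A)"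
      unfolding N[OF that] by (intro emeasure_mono A) auto
    also have "\<dots> = emeasure (distr M borel fst) A"
      by (subst emeasure_distr) (auto simp: sp)
    also have "\<dots> = emeasure lborel ({0..1} \<inter> A)" by (simp add: M(3) divide_ennreal_def)
    finally show ?thesis .
  qed
  have "absolutely_continuous lborel N"
    unfolding absolutely_continuous_def
  proof
    fix A :: "real set" assume A: "A \<in> null_sets lborel"
    then have Ab: "A \<in> sets borel" by auto
    have "emeasure N A \<le> emeasure lborel A"
      using NL[OF Ab] emeasure_mono[of "{0..1} \<inter> A" A lborel] Ab by simp
    then show "A \<in> null_sets N" using A Ab by (auto simp: null_sets_def N_def)
  qed
  then obtain h where h: "h \<in> borel_measurable lborel" "density lborel h = N"
    using sigma_finite_measure.Radon_Nikodym[OF sigma_finite_lborel, of N] by (auto simp: N_def)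
  note [measurable] = h(1)
  define f where "f = (\<lambda>s. enn2real (h s))"
  have Nh: "(\<integral>\<^sup>+s. h s * indicator A s \<partial>lborel) = emeasure N A" if "A \<in> sets borel" for A
    using that by (subst h(2)[symmetric]) (simp add: emeasure_density)
  have Nfin: "emeasure N A \<noteq> \<infinity>" if "A \<in> sets borel" for A using N[OF that] by simp
  have "AE s in lborel. h s \<noteq> \<infinity>"
    using Nh[of UNIV] Nfin[of UNIV] by (intro nn_integral_PInf_AE) auto
  then have hf: "AE s in lborel. h s = ennreal (f s)"
    by eventually_elim (simp add: f_def less_top)
  have Nf: "(\<integral>\<^sup>+s. ennreal (indicator A s * f s) \<partial>lborel) = emeasure N A" if "A \<in> sets borel" for A
    unfolding Nh[OF that, symmetric]
    by (intro nn_integral_cong_AE) (use hf in \<open>eventually_elim, auto split: split_indicator\<close>)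
  have fm [measurable]: "f \<in> borel_measurable borel" using h(1) by (simp add: f_def)
  have fint: "integrable lborel f"
  proof (rule integrableI_nonneg)
    show "AE x in lborel. 0 \<le> f x" by (simp add: f_def)
    show "(\<integral>\<^sup>+ x. ennreal (f x) \<partial>lborel) < \<infinity>" using Nf[of UNIV] Nfin[of UNIV] by (simp add: less_top)
  qed simp
  have Lf: "(LINT s:A|lborel. f s) = measure N A" if [measurable]: "A \<in> sets borel" for A
    unfolding set_lebesgue_integral_def measure_def Nf[OF that, symmetric]
    by (subst integral_eq_nn_integral) (auto simp: f_def)
  \<comment> \<open>A density is determined by its integrals over Borel sets, so domination of $N$ bounds $f$.\<close>
  have "AE s in lborel. 0 \<le> indicator {0..1} s - f s"
  proof (rule sigma_finite_measure.density_nonneg[OF sigma_finite_lborel])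
    have i1: "integrable lborel (indicator {0..1::real} :: real \<Rightarrow> real)"
      by (intro integrable_real_indicator) auto
    then show "integrable lborel (\<lambda>s. indicator {0..1} s - f s)" using fint by simp
    fix A :: "real set" assume "A \<in> sets lborel"
    then have A [measurable]: "A \<in> sets borel" by simp
    have "measure N A \<le> measure lborel ({0..1} \<inter> A)"
      unfolding measure_def
    proof (rule enn2real_mono[OF NL[OF A]])
      have "emeasure lborel ({0..1} \<inter> A) \<le> emeasure lborel {0..1::real}"
        using A by (intro emeasure_mono) auto
      then show "emeasure lborel ({0..1} \<inter> A) < \<top>" by (auto simp: less_top[symmetric] top_unique)
    qed
    moreover have "(LINT s:A|lborel. indicator {0..1} s - f s)
      = (LINT s:A|lborel. indicator {0..1} s) - (LINT s:A|lborel. f s)"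
      using fint i1 A unfolding set_integrable_def
      by (intro set_integral_diff) (auto simp: set_integrable_def intro!: integrable_mult_indicator simp del: real_scaleR_def)
    moreover have "(LINT s:A|lborel. indicator {0..1} s) = measure lborel ({0..1} \<inter> A)"
      unfolding set_lebesgue_integral_def
      by (simp add: indicator_inter_arith[symmetric] Int_commute)
    ultimately show "0 \<le> (LINT s:A|lborel. indicator {0..1} s - f s)"
      by (simp add: Lf)
  qed
  then have bnd: "AE s in lborel. 0 \<le> f s \<and> f s \<le> indicator {0..1} s"
    by eventually_elim (simp add: f_def)
  show ?thesis
  proof (rule that[OF fint])
    fix u :: real assume u: "u \<in> {0..1}"
    have "C u v = measure N {..u}"
      using M(4)[OF u v] N[of "{..u}"] by (simp add: measure_def)
    also have "\<dots> = (LINT s:{..u}|lborel. f s)" by (simp add: Lf)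
    also have "\<dots> = (LINT s:{0..u}|lborel. f s)"
      unfolding set_lebesgue_integral_def
    proof (rule integral_cong_AE)
      show "AE x in lborel. indicator {..u} x *\<^sub>R f x = indicator {0..u} x *\<^sub>R f x"
        using bnd by eventually_elim (auto split: split_indicator)
    qed simp_all
    finally show "C u v = (LINT s:{0..u}|lborel. f s)" .
  next
    show "AE t in lborel. 0 \<le> f t \<and> f t \<le> 1"
      using bnd by eventually_elim (auto split: split_indicator_asm)
  qed
qed

lemma copula_right_margin:
  assumes "copula2 C" and u: "u \<in> {0..1}"
  shows "C u 1 = u"
proof -
  obtain M :: "(real \<times> real) measure" where M: "prob_space M" "sets M = sets borel"
    "distr M borel fst = uniform_measure lborel {0..1}"
    "distr M borel snd = uniform_measure lborel {0..1}"
    "\<And>u v. u \<in> {0..1} \<Longrightarrow> v \<in> {0..1} \<Longrightarrow> C u v = measure M ({..u} \<times> {..v})"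
    using assms unfolding copula2_def by blast
  interpret prob_space M by (rule M(1))
  have sp: "space M = UNIV" using sets_eq_imp_space_eq[OF M(2)] by simp
  have fs [measurable]: "fst \<in> borel_measurable M" "snd \<in> borel_measurable M"
    by (simp_all add: measurable_cong_sets[OF M(2) refl] borel_prod[symmetric])
  have "prob (snd -` {1<..}) = measure (distr M borel snd) {1<..}"
    by (subst measure_distr) (auto simp: sp)
  also have "\<dots> = measure lborel ({0..1::real} \<inter> {1<..})"
    unfolding M(4) by (subst measure_uniform_measure) auto
  also have "{0..1} \<inter> {1<..} = ({} :: real set)" by auto
  also have "measure lborel ({} :: real set) = 0" by simp
  finally have "AE x in M. x \<notin> snd -` {1<..}"
    using measurable_sets[OF fs(2), of "{1<..}"] sp by (subst (asm) prob_eq_0) auto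
  then have le1: "AE x in M. snd x \<le> 1" by eventually_elim auto
  have "C u 1 = prob ({..u} \<times> {..1})" using M(5)[OF u, of 1] by simp
  also have "\<dots> = prob (fst -` {..u})"
  proof (rule measure_eq_AE)
    show "AE x in M. (x \<in> {..u} \<times> {..1}) = (x \<in> fst -` {..u})"
      using le1 by eventually_elim auto
    show "{..u} \<times> {..1} \<in> sets M" by (simp add: M(2) borel_prod[symmetric])
    show "fst -` {..u} \<in> sets M" using measurable_sets[OF fs(1), of "{..u}"] sp by simp
  qed
  also have "\<dots> = measure (distr M borel fst) {..u}" by (subst measure_distr) (auto simp: sp)
  also have "\<dots> = measure lborel ({0..1} \<inter> {..u})"
    unfolding M(3) by (subst measure_uniform_measure) auto
  also have "{0..1} \<inter> {..u} = {0..u}" using u by auto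
  finally show ?thesis using u by simp
qed

lemma markov_product_eq_integral:
  assumes [measurable]: "f \<in> borel_measurable borel" "g \<in> borel_measurable borel"
    and f: "AE t in lebesgue. t \<in> {0..1} \<longrightarrow> partial2 D u t = f t"
    and g: "AE t in lebesgue. t \<in> {0..1} \<longrightarrow> partial1 C t v = g t"
  shows "markov_product D C u v = (LINT t:{0..1}|lborel. f t * g t)"
proof -
  let ?p = "\<lambda>t. indicator {0..1} t *\<^sub>R (partial2 D u t * partial1 C t v)"
  let ?q = "\<lambda>t. indicator {0..1} t *\<^sub>R (f t * g t)"
  have eq: "AE t in lebesgue. ?q t = ?p t"
    using f g by eventually_elim (auto split: split_indicator)
  have q: "?q \<in> borel_measurable lborel" by measurable
  then have "?q \<in> borel_measurable lebesgue" by (rule measurable_completion)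
  then have "integral\<^sup>L lebesgue ?p = integral\<^sup>L lebesgue ?q"
    using eq borel_measurable_lebesgue_cong_AE[OF _ eq] by (intro integral_cong_AE) auto
  also have "\<dots> = integral\<^sup>L lborel ?q" using q by (rule integral_completion)
  finally show ?thesis by (simp add: markov_product_def set_lebesgue_integral_def)
qed

section \<open>Monotone derivatives\<close>

text \<open>The extension takes at $u$ the supremum of the values to the right of $u$. Inserting the
  lower bound $L$ keeps this set nonempty where $S$ has no point to the right.\<close>
lemma antimono_on_extend:
  fixes \<phi> :: "real \<Rightarrow> real"
  assumes anti: "antimono_on S \<phi>" and bnd: "\<And>t. t \<in> S \<Longrightarrow> L \<le> \<phi> t \<and> \<phi> t \<le> K"
  obtains g where "antimono g" "\<forall>t\<in>S. g t = \<phi> t"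
proof -
  define g where "g = (\<lambda>u. Sup (insert L (\<phi> ` {t\<in>S. u \<le> t})))"
  have bdd: "bdd_above (insert L (\<phi> ` {t\<in>S. u \<le> t}))" for u
    using bnd by (intro bdd_aboveI[of _ "max L K"]) (auto simp: le_max_iff_disj)
  show ?thesis
  proof
    show "antimono g"
      unfolding g_def by (intro antimonoI cSup_subset_mono bdd) auto
    have "g t = \<phi> t" if "t \<in> S" for t
      unfolding g_def
    proof (rule cSup_eq_maximum)
      show "\<phi> t \<in> insert L (\<phi> ` {s\<in>S. t \<le> s})" using that by auto
      show "y \<le> \<phi> t" if "y \<in> insert L (\<phi> ` {s\<in>S. t \<le> s})" for y
        using that \<open>t \<in> S\<close> anti bnd by (auto dest: monotone_onD)
    qed
    then show "\<forall>t\<in>S. g t = \<phi> t" by simp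
  qed
qed

text \<open>The inequality for $a = s$, $u = s + h$, $b = t + h$, where $a + b - u = t$, compares the
  difference quotients of $c$ at $t$ and at $s$ for the same increment $h$.\<close>
lemma derivative_antimono_of_four_point:
  fixes c :: "real \<Rightarrow> real"
  assumes four: "\<And>a u b. 0 \<le> a \<Longrightarrow> a \<le> u \<Longrightarrow> u \<le> b \<Longrightarrow> b \<le> 1 \<Longrightarrow> c a + c b \<le> c u + c (a + b - u)"
    and s: "0 < s" "s < t" "t < 1"
    and p: "(c has_real_derivative p) (at s)" and q: "(c has_real_derivative q) (at t)"
  shows "q \<le> p"
proof (rule tendsto_le)
  show "((\<lambda>h. (c (s + h) - c s) / h) \<longlongrightarrow> p) (at_right 0)"
    using p unfolding DERIV_def by (rule tendsto_within_subset) simp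
  show "((\<lambda>h. (c (t + h) - c t) / h) \<longlongrightarrow> q) (at_right 0)"
    using q unfolding DERIV_def by (rule tendsto_within_subset) simp
  show "\<forall>\<^sub>F h in at_right 0. (c (t + h) - c t) / h \<le> (c (s + h) - c s) / h"
    unfolding eventually_at_right_field
  proof (intro exI[of _ "1 - t"] conjI allI impI)
    fix h :: real assume h: "0 < h" "h < 1 - t"
    show "(c (t + h) - c t) / h \<le> (c (s + h) - c s) / h"
      using four[of s "s + h" "t + h"] h s by (intro divide_right_mono) auto
  qed (use s in simp)
qed simp

lemma AE_derivative_eq_antimono:
  fixes c f :: "real \<Rightarrow> real"
  assumes four: "\<And>a u b. 0 \<le> a \<Longrightarrow> a \<le> u \<Longrightarrow> u \<le> b \<Longrightarrow> b \<le> 1 \<Longrightarrow> c a + c b \<le> c u + c (a + b - u)"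
    and deriv: "AE t in lebesgue. t \<in> {0..1} \<longrightarrow> t \<in> {0<..<1} \<and> (c has_real_derivative f t) (at t)"
    and bnd: "AE t in lebesgue. L \<le> f t \<and> f t \<le> K"
  obtains g where "antimono g" "AE t in lebesgue. t \<in> {0..1} \<longrightarrow> f t = g t"
proof -
  define S where "S = {t\<in>{0<..<1}. (c has_real_derivative f t) (at t) \<and> L \<le> f t \<and> f t \<le> K}"
  have "antimono_on S f"
  proof (rule monotone_onI)
    fix s t assume st: "s \<in> S" "t \<in> S" "s \<le> t"
    show "f t \<le> f s"
    proof (cases "s = t")
      case False
      with st have "0 < s" "s < t" "t < 1"
        and "(c has_real_derivative f s) (at s)" "(c has_real_derivative f t) (at t)"
        by (auto simp: S_def)
      then show ?thesis by (rule derivative_antimono_of_four_point[rotated]) (rule four)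
    qed simp
  qed
  moreover have "L \<le> f t \<and> f t \<le> K" if "t \<in> S" for t using that by (simp add: S_def)
  ultimately obtain g where g: "antimono g" "\<forall>t\<in>S. g t = f t"
    by (rule antimono_on_extend)
  have "AE t in lebesgue. t \<in> {0..1} \<longrightarrow> f t = g t"
    using deriv bnd by eventually_elim (auto simp: S_def g(2))
  with g(1) show ?thesis by (rule that)
qed

text \<open>The bathtub principle. Since $f - g(u)$ is nonnegative left of $u$ and nonpositive right of
  $u$, one has $(d - 1_{[0,u]})(f - g(u)) \le 0$ almost everywhere; the constant $g(u)$ drops out after
  integration because $d$ and $1_{[0,u]}$ have the same integral.\<close>
lemma integral_mult_le_of_antimono:
  fixes d f g :: "real \<Rightarrow> real"
  assumes d: "integrable lborel d" "AE t in lborel. 0 \<le> d t \<and> d t \<le> 1"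
    and u: "u \<in> {0..1}" "(LINT t:{0..1}|lborel. d t) = u"
    and f: "integrable lborel f"
    and g: "antimono_on {0..1} g" "AE t in lborel. t \<in> {0..1} \<longrightarrow> f t = g t"
  shows "(LINT t:{0..1}|lborel. d t * f t) \<le> (LINT t:{0..u}|lborel. f t)"
proof -
  have [measurable]: "d \<in> borel_measurable borel" "f \<in> borel_measurable borel" using d f by auto
  have df: "integrable lborel (\<lambda>t. d t * f t)"
  proof (rule Bochner_Integration.integrable_bound[OF f])
    show "AE t in lborel. norm (d t * f t) \<le> norm (f t)"
      using d(2) by eventually_elim (auto simp: abs_mult intro: mult_left_le_one_le)
  qed simp
  have I: "integrable lborel (\<lambda>t. indicator {0..w} t * k t)" if "integrable lborel k" for k :: "real \<Rightarrow> real" and w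
    using integrable_mult_indicator[of "{0..w}" lborel k] that by simp
  have I1: "integrable lborel (indicator {0..u} :: real \<Rightarrow> real)"
    using u by (intro integrable_real_indicator) auto
  have "(LINT t|lborel. indicator {0..1} t * (d t * f t))
      \<le> (LINT t|lborel. indicator {0..u} t * f t + g u * (indicator {0..1} t * d t - indicator {0..u} t))"
  proof (rule integral_mono_AE)
    show "AE t in lborel. indicator {0..1} t * (d t * f t)
      \<le> indicator {0..u} t * f t + g u * (indicator {0..1} t * d t - indicator {0..u} t)"
      using d(2) g(2)
    proof eventually_elim
      case (elim t)
      consider "t \<notin> {0..1}" | "t \<in> {0..u}" | "t \<in> {u<..1}" using u by fastforce
      then show ?case
      proof cases
        case 1
        then show ?thesis using u by (auto simp: indicator_def)
      next
        case 2
        then have "g u \<le> f t" using elim monotone_onD[OF g(1), of t u] u by auto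
        then have "(1 - d t) * g u \<le> (1 - d t) * f t" using elim by (intro mult_left_mono) auto
        then show ?thesis using 2 u by (simp add: indicator_def algebra_simps)
      next
        case 3
        then have "f t \<le> g u" using elim monotone_onD[OF g(1), of u t] u by auto
        then have "d t * f t \<le> d t * g u" using elim by (intro mult_left_mono) auto
        then show ?thesis using 3 u by (simp add: indicator_def algebra_simps)
      qed
    qed
  qed (intro I df f d Bochner_Integration.integrable_add Bochner_Integration.integrable_diff integrable_mult_right I1)+
  also have "\<dots> = (LINT t|lborel. indicator {0..u} t * f t)
      + g u * ((LINT t|lborel. indicator {0..1} t * d t) - (LINT t|lborel. indicator {0..u} t))"
    using I[OF f] I[OF d(1)] I1 by simp
  also have "(LINT t|lborel. indicator {0..u} t) = u" using u by simp
  also have "(LINT t|lborel. indicator {0..1} t * d t) = u"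
    using u by (simp add: set_lebesgue_integral_def)
  finally show ?thesis by (simp add: set_lebesgue_integral_def)
qed

section \<open>Reflection copulas\<close>

definition reflect :: "real \<Rightarrow> real \<Rightarrow> real \<Rightarrow> real" where
  "reflect a b x = (if a \<le> x \<and> x \<le> b then a + b - x else x)"

lemma borel_measurable_reflect [measurable]: "reflect a b \<in> borel_measurable borel"
  unfolding reflect_def by measurable

lemma reflect_reflect [simp]: "reflect a b (reflect a b x) = x"
  by (auto simp: reflect_def)

lemma emeasure_lborel_vimage_reflect:
  assumes [measurable]: "B \<in> sets borel"
  shows "emeasure lborel (reflect a b -` B) = emeasure lborel B"
proof -
  let ?R = "\<lambda>x. (a + b) + (- 1) * x"
  have "lborel = density (distr lborel borel ?R) (\<lambda>_. ennreal \<bar>- 1\<bar>)"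
    by (rule lborel_real_affine) simp
  then have R: "distr lborel borel ?R = lborel"
    by (simp add: density_1 flip: one_ennreal_def)
  have 1: "?R -` (B \<inter> {a..b}) \<in> sets borel" "B - {a..b} \<in> sets borel"
    using measurable_sets_borel[of ?R borel "B \<inter> {a..b}"] by auto
  have "reflect a b -` B = ?R -` (B \<inter> {a..b}) \<union> (B - {a..b})"
    by (auto simp: reflect_def split: if_splits)
  also have "emeasure lborel \<dots> = emeasure lborel (?R -` (B \<inter> {a..b})) + emeasure lborel (B - {a..b})"
    using 1 by (intro plus_emeasure[symmetric]) auto
  also have "emeasure lborel (?R -` (B \<inter> {a..b})) = emeasure (distr lborel borel ?R) (B \<inter> {a..b})"
    by (subst emeasure_distr) auto
  also have "\<dots> = emeasure lborel (B \<inter> {a..b})" by (simp only: R)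
  also have "emeasure lborel (B \<inter> {a..b}) + emeasure lborel (B - {a..b}) = emeasure lborel ((B \<inter> {a..b}) \<union> (B - {a..b}))"
    by (intro plus_emeasure) auto
  also have "(B \<inter> {a..b}) \<union> (B - {a..b}) = B" by auto
  finally show ?thesis .
qed

text \<open>Take the law of $(U, TU)$ for $U$ uniform and $T$ the reflection of $[a,b]$. As $T$ is a
  measure-preserving involution, $\{U \le u, TU \le w\}$ has the same probability as
  $\{TU \le u, U \le w\}$, and $\{y.\; Ty \le u\}$ is the union in the conclusion.\<close>
lemma ex_reflection_copula:
  assumes au: "0 \<le> a" "a \<le> u" "u \<le> b" "b \<le> 1"
  obtains D where "copula2 D"
    "\<And>w. w \<in> {0..1} \<Longrightarrow> D u w = (LINT s:{0..w}|lborel. indicator ({..<a} \<union> {a + b - u..b}) s)"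
proof -
  let ?U = "uniform_measure lborel {0..1::real}"
  let ?T = "reflect a b"
  define M where "M = distr ?U borel (\<lambda>x. (x, ?T x))"
  have m [measurable]: "(\<lambda>x. (x, ?T x)) \<in> ?U \<rightarrow>\<^sub>M (borel :: (real \<times> real) measure)"
    by (simp add: borel_prod[symmetric])
  have fst_snd [measurable]: "fst \<in> borel_measurable (borel :: (real \<times> real) measure)"
    "snd \<in> borel_measurable (borel :: (real \<times> real) measure)"
    by (simp_all add: borel_prod[symmetric])
  have T01: "?T x \<in> {0..1} \<longleftrightarrow> x \<in> {0..1}" for x using au by (auto simp: reflect_def)
  have dT: "distr ?U borel ?T = ?U"
  proof (rule measure_eqI)
    fix B assume "B \<in> sets (distr ?U borel ?T)"
    then have B [measurable]: "B \<in> sets borel" by simp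
    have vB [measurable]: "?T -` B \<in> sets borel"
      by (rule measurable_sets_borel[OF borel_measurable_reflect B])
    have "{0..1} \<inter> ?T -` B = ?T -` ({0..1} \<inter> B)" using T01 by auto
    then have "emeasure lborel ({0..1} \<inter> ?T -` B) = emeasure lborel ({0..1} \<inter> B)"
      by (simp only:) (rule emeasure_lborel_vimage_reflect, simp)
    then show "emeasure (distr ?U borel ?T) B = emeasure ?U B"
      by (subst emeasure_distr) auto
  qed simp
  have pU: "prob_space ?U" by (rule prob_space_uniform_measure) auto
  have "copula2 (\<lambda>u v. measure M ({..u} \<times> {..v}))"
    unfolding copula2_def
  proof (intro exI[of _ M] conjI ballI refl)
    show "prob_space M" unfolding M_def by (rule prob_space.prob_space_distr[OF pU m])
    show "sets M = sets borel" by (simp add: M_def)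
    have "distr ?U borel (\<lambda>x. x) = ?U"
      by (rule distr_id2) simp
    then show "distr M borel fst = ?U" unfolding M_def by (subst distr_distr) (auto simp: comp_def)
    show "distr M borel snd = ?U" unfolding M_def using dT by (subst distr_distr) (auto simp: comp_def)
  qed
  moreover have "measure M ({..u} \<times> {..w}) = (LINT s:{0..w}|lborel. indicator ({..<a} \<union> {a + b - u..b}) s)"
    if w: "w \<in> {0..1}" for w
  proof -
    let ?A = "{..<a} \<union> {a + b - u..b}"
    have A: "?T y \<le> u \<longleftrightarrow> y \<in> ?A" for y using au by (auto simp: reflect_def)
    have A': "x \<le> u \<longleftrightarrow> ?T x \<in> ?A" for x using A[of "?T x"] by (simp only: reflect_reflect)
    have "measure M ({..u} \<times> {..w}) = measure ?U ((\<lambda>x. (x, ?T x)) -` ({..u} \<times> {..w}))"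
      unfolding M_def by (subst measure_distr) (auto simp: borel_prod[symmetric])
    also have "(\<lambda>x. (x, ?T x)) -` ({..u} \<times> {..w}) = ?T -` (?A \<inter> {..w})"
      using A' by (intro set_eqI) (simp only: vimage_eq mem_Times_iff fst_conv snd_conv atMost_iff Int_iff)
    also have "measure ?U (?T -` (?A \<inter> {..w})) = measure (distr ?U borel ?T) (?A \<inter> {..w})"
      by (subst measure_distr) auto
    also have "\<dots> = measure lborel ({0..1} \<inter> (?A \<inter> {..w}))"
      unfolding dT by (subst measure_uniform_measure) auto
    also have "{0..1} \<inter> (?A \<inter> {..w}) = ?A \<inter> {0..w}" using w by auto
    also have "measure lborel (?A \<inter> {0..w}) = (LINT s:{0..w}|lborel. indicator ?A s)"
      unfolding set_lebesgue_integral_def by (simp add: indicator_inter_arith[symmetric] Int_commute)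
    finally show ?thesis .
  qed
  ultimately show ?thesis by (rule that)
qed

section \<open>The Markov product as an integral of densities\<close>

lemma copula_section:
  assumes C: "copula2 C" and v: "v \<in> {0..1}"
  obtains f where "integrable lborel f"
    and "\<And>u. u \<in> {0..1} \<Longrightarrow> C u v = (LINT s:{0..u}|lborel. f s)"
    and "AE t in lebesgue. 0 \<le> f t \<and> f t \<le> 1"
    and "AE t in lebesgue. t \<in> {0..1} \<longrightarrow> t \<in> {0<..<1} \<and> ((\<lambda>s. C s v) has_real_derivative f t) (at t)"
    and "AE t in lebesgue. t \<in> {0..1} \<longrightarrow> partial1 C t v = f t"
proof -
  obtain f where f: "integrable lborel f"
    "\<And>u. u \<in> {0..1} \<Longrightarrow> C u v = (LINT s:{0..u}|lborel. f s)"
    "AE t in lborel. 0 \<le> f t \<and> f t \<le> 1"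
    using copula_section_density[OF C v] by blast
  have d: "AE t in lebesgue. t \<in> {0..1} \<longrightarrow> t \<in> {0<..<1} \<and> ((\<lambda>s. C s v) has_real_derivative f t) (at t)"
    by (rule AE_has_derivative_of_density[OF f(1)]) (rule f(2))
  have p: "AE t in lebesgue. t \<in> {0..1} \<longrightarrow> partial1 C t v = f t"
    using d by eventually_elim (auto simp: partial1_def intro: DERIV_imp_deriv)
  show ?thesis by (rule that[OF f(1) f(2) AE_completion[OF f(3)] d p])
qed

lemma markov_product_section:
  assumes C: "copula2 C" and D: "copula2 D" and u: "u \<in> {0..1}"
    and f: "integrable lborel f" "AE t in lebesgue. t \<in> {0..1} \<longrightarrow> partial1 C t v = f t"
  obtains d where "integrable lborel d" "AE t in lborel. 0 \<le> d t \<and> d t \<le> 1"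
    "(LINT t:{0..1}|lborel. d t) = u"
    "markov_product D C u v = (LINT t:{0..1}|lborel. d t * f t)"
proof -
  obtain d where d: "integrable lborel d"
    "\<And>w. w \<in> {0..1} \<Longrightarrow> D u w = (LINT s:{0..w}|lborel. d s)"
    "AE t in lebesgue. 0 \<le> d t \<and> d t \<le> 1"
    "AE t in lebesgue. t \<in> {0..1} \<longrightarrow> partial1 (\<lambda>t u. D u t) t u = d t"
    by (rule copula_section[OF copula2_swap[OF D] u]) blast
  have p: "AE t in lebesgue. t \<in> {0..1} \<longrightarrow> partial2 D u t = d t"
    using d(4) by (simp add: partial1_def partial2_def)
  have "markov_product D C u v = (LINT t:{0..1}|lborel. d t * f t)"
    using d(1) f(1) by (intro markov_product_eq_integral p f(2)) auto
  moreover have "(LINT t:{0..1}|lborel. d t) = u"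
    using d(2)[of 1] copula_right_margin[OF D u] by simp
  ultimately show ?thesis using d(1,3) that by (simp add: AE_completion_iff)
qed

text \<open>The weight $\partial_2 D(u,\cdot)$ is the indicator of $[0,a] \cup [a+b-u,b]$, and integrating
  the derivative of $t \mapsto C(t,v)$ over these two intervals leaves three boundary values,
  because $C(0,v) = 0$.\<close>
lemma markov_product_reflection:
  assumes au: "0 \<le> a" "a \<le> u" "u \<le> b" "b \<le> 1"
  obtains D where "copula2 D"
    "\<And>C v. copula2 C \<Longrightarrow> v \<in> {0..1} \<Longrightarrow> markov_product D C u v = C a v + C b v - C (a + b - u) v"
proof -
  let ?A = "{..<a} \<union> {a + b - u..b}"
  obtain D where D: "copula2 D"
    "\<And>w. w \<in> {0..1} \<Longrightarrow> D u w = (LINT s:{0..w}|lborel. indicator ?A s)"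
    using ex_reflection_copula[OF au] by blast
  \<comment> \<open>$A$ is unbounded to the left; only its part in the unit interval has an integrable indicator.\<close>
  let ?d = "\<lambda>s. indicator {0..1} s * indicator ?A s :: real"
  have dint: "integrable lborel ?d"
  proof -
    have "integrable lborel (\<lambda>s. indicator ({0..1} \<inter> ?A) s :: real)"
    proof (rule integrable_real_indicator)
      have "emeasure lborel ({0..1} \<inter> ?A) \<le> emeasure lborel {0..1::real}"
        by (intro emeasure_mono) auto
      then show "emeasure lborel ({0..1} \<inter> ?A) < \<infinity>" by (auto simp: less_top[symmetric] top_unique)
    qed simp
    then show ?thesis by (simp only: indicator_inter_arith)
  qed
  have Dd: "D u w = (LINT s:{0..w}|lborel. ?d s)" if "w \<in> {0..1}" for w
    unfolding D(2)[OF that] set_lebesgue_integral_def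
    by (intro Bochner_Integration.integral_cong) (use that in \<open>auto split: split_indicator\<close>)
  have "AE t in lebesgue. t \<in> {0..1} \<longrightarrow> t \<in> {0<..<1} \<and> (D u has_real_derivative ?d t) (at t)"
    by (rule AE_has_derivative_of_density[OF dint]) (rule Dd)
  then have pD: "AE t in lebesgue. t \<in> {0..1} \<longrightarrow> partial2 D u t = ?d t"
    by eventually_elim (auto simp: partial2_def intro: DERIV_imp_deriv)
  show ?thesis
  proof (rule that[OF D(1)])
    fix C v assume C: "copula2 C" and v: "v \<in> {0..1::real}"
    obtain f where f: "integrable lborel f"
      "\<And>u. u \<in> {0..1} \<Longrightarrow> C u v = (LINT s:{0..u}|lborel. f s)"
      "AE t in lebesgue. t \<in> {0..1} \<longrightarrow> partial1 C t v = f t"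
      by (rule copula_section[OF C v]) blast
    have [measurable]: "f \<in> borel_measurable borel" using f(1) by auto
    have I: "integrable lborel (\<lambda>t. indicator {0..w} t * f t)" for w
      using integrable_mult_indicator[of "{0..w}" lborel f] f(1) by simp
    have "markov_product D C u v = (LINT t:{0..1}|lborel. ?d t * f t)"
      by (intro markov_product_eq_integral pD f(3)) auto
    also have "\<dots> = (LINT t|lborel. indicator {0..a} t * f t + indicator {0..b} t * f t
        - indicator {0..a + b - u} t * f t)"
      unfolding set_lebesgue_integral_def
    proof (rule integral_cong_AE)
      show "AE t in lborel. indicator {0..1} t *\<^sub>R (?d t * f t) = indicator {0..a} t * f t
          + indicator {0..b} t * f t - indicator {0..a + b - u} t * f t"
        using AE_lborel_singleton[of a] AE_lborel_singleton[of "a + b - u"]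
        by eventually_elim (use au in \<open>auto simp: indicator_def\<close>)
    qed measurable
    also have "\<dots> = C a v + C b v - C (a + b - u) v"
      using I au f(2)[of a] f(2)[of b] f(2)[of "a + b - u"] by (simp add: set_lebesgue_integral_def)
    finally show "markov_product D C u v = C a v + C b v - C (a + b - u) v" .
  qed
qed

section \<open>Characterisation of stochastic monotonicity\<close>

theorem theorem4p2:
  fixes C :: "real \<Rightarrow> real \<Rightarrow> real"
  assumes "copula2 C"
  shows "(stoch_increasing1 C \<longleftrightarrow>
            (\<forall>D. copula2 D \<longrightarrow>
               (\<forall>u\<in>{0..1}. \<forall>v\<in>{0..1}. markov_product D C u v \<le> C u v))) \<and>
         (stoch_decreasing1 C \<longleftrightarrow>
            (\<forall>D. copula2 D \<longrightarrow>
               (\<forall>u\<in>{0..1}. \<forall>v\<in>{0..1}. C u v \<le> markov_product D C u v)))"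
proof (intro conjI iffI allI impI ballI)
  note C = assms
  fix D u v assume D: "copula2 D" and u: "u \<in> {0..1::real}" and v: "v \<in> {0..1::real}"
  obtain f where f: "integrable lborel f"
    "\<And>u. u \<in> {0..1} \<Longrightarrow> C u v = (LINT s:{0..u}|lborel. f s)"
    "AE t in lebesgue. t \<in> {0..1} \<longrightarrow> partial1 C t v = f t"
    by (rule copula_section[OF C v]) blast
  obtain d where d: "integrable lborel d" "AE t in lborel. 0 \<le> d t \<and> d t \<le> 1"
    "(LINT t:{0..1}|lborel. d t) = u" "markov_product D C u v = (LINT t:{0..1}|lborel. d t * f t)"
    by (rule markov_product_section[OF C D u f(1,3)])
  have AE_eq: "AE t in lborel. t \<in> {0..1} \<longrightarrow> f t = g t"
    if "AE t in lebesgue. t \<in> {0..1} \<longrightarrow> partial1 C t v = g t" for g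
  proof -
    have "AE t in lebesgue. t \<in> {0..1} \<longrightarrow> f t = g t"
      using that f(3) by eventually_elim auto
    then show ?thesis by (simp add: AE_completion_iff)
  qed
  show "markov_product D C u v \<le> C u v" if mon: "stoch_increasing1 C"
  proof -
    obtain g where "antimono_on {0..1} g \<and> (AE t in lebesgue. t \<in> {0..1} \<longrightarrow> partial1 C t v = g t)"
      using bspec[OF mon[unfolded stoch_increasing1_def] v] by (rule exE)
    then have g: "antimono_on {0..1} g" "AE t in lebesgue. t \<in> {0..1} \<longrightarrow> partial1 C t v = g t"
      by auto
    show ?thesis
      using integral_mult_le_of_antimono[OF d(1,2) u d(3) f(1) g(1) AE_eq[OF g(2)]] d(4) f(2)[OF u] by simp
  qed
  show "C u v \<le> markov_product D C u v" if mon: "stoch_decreasing1 C"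
  proof -
    obtain g where "mono_on {0..1} g \<and> (AE t in lebesgue. t \<in> {0..1} \<longrightarrow> partial1 C t v = g t)"
      using bspec[OF mon[unfolded stoch_decreasing1_def] v] by (rule exE)
    then have g: "mono_on {0..1} g" "AE t in lebesgue. t \<in> {0..1} \<longrightarrow> partial1 C t v = g t"
      by auto
    have "antimono_on {0..1} (\<lambda>t. - g t)" using g(1) by (auto simp: monotone_on_def)
    moreover have "AE t in lborel. t \<in> {0..1} \<longrightarrow> - f t = - g t"
      using AE_eq[OF g(2)] by eventually_elim simp
    ultimately have "(LINT t:{0..1}|lborel. d t * - f t) \<le> (LINT t:{0..u}|lborel. - f t)"
      using f(1) by (intro integral_mult_le_of_antimono[OF d(1,2) u d(3)]) auto
    then show ?thesis using d(4) f(2)[OF u] by (simp add: set_lebesgue_integral_def)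
  qed
next
  note C = assms
  assume le: "\<forall>D. copula2 D \<longrightarrow> (\<forall>u\<in>{0..1}. \<forall>v\<in>{0..1}. markov_product D C u v \<le> C u v)"
  show "stoch_increasing1 C"
    unfolding stoch_increasing1_def
  proof
    fix v :: real assume v: "v \<in> {0..1}"
    obtain f where f: "AE t in lebesgue. 0 \<le> f t \<and> f t \<le> 1"
      "AE t in lebesgue. t \<in> {0..1} \<longrightarrow> t \<in> {0<..<1} \<and> ((\<lambda>s. C s v) has_real_derivative f t) (at t)"
      "AE t in lebesgue. t \<in> {0..1} \<longrightarrow> partial1 C t v = f t"
      by (rule copula_section[OF C v]) blast
    have four: "C a v + C b v \<le> C u v + C (a + b - u) v" if ab: "0 \<le> a" "a \<le> u" "u \<le> b" "b \<le> 1" for a u b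
    proof -
      obtain D where D: "copula2 D" "markov_product D C u v = C a v + C b v - C (a + b - u) v"
        using markov_product_reflection[OF ab] C v by metis
      have "u \<in> {0..1}" using ab by simp
      then have "markov_product D C u v \<le> C u v" using le D(1) v by blast
      then show ?thesis using D(2) by linarith
    qed
    obtain g where "antimono g" "AE t in lebesgue. t \<in> {0..1} \<longrightarrow> f t = g t"
      by (rule AE_derivative_eq_antimono[OF four f(2,1)])
    then show "\<exists>g. antimono_on {0..1} g \<and> (AE t in lebesgue. t \<in> {0..1} \<longrightarrow> partial1 C t v = g t)"
      using f(3) by (intro exI[of _ g] conjI) (auto simp: monotone_on_def elim: AE_mp)
  qed
next
  note C = assms
  assume ge: "\<forall>D. copula2 D \<longrightarrow> (\<forall>u\<in>{0..1}. \<forall>v\<in>{0..1}. C u v \<le> markov_product D C u v)"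
  show "stoch_decreasing1 C"
    unfolding stoch_decreasing1_def
  proof
    fix v :: real assume v: "v \<in> {0..1}"
    obtain f where f: "AE t in lebesgue. 0 \<le> f t \<and> f t \<le> 1"
      "AE t in lebesgue. t \<in> {0..1} \<longrightarrow> t \<in> {0<..<1} \<and> ((\<lambda>s. C s v) has_real_derivative f t) (at t)"
      "AE t in lebesgue. t \<in> {0..1} \<longrightarrow> partial1 C t v = f t"
      by (rule copula_section[OF C v]) blast
    have four: "- C a v + - C b v \<le> - C u v + - C (a + b - u) v" if ab: "0 \<le> a" "a \<le> u" "u \<le> b" "b \<le> 1" for a u b
    proof -
      obtain D where D: "copula2 D" "markov_product D C u v = C a v + C b v - C (a + b - u) v"
        using markov_product_reflection[OF ab] C v by metis
      have "u \<in> {0..1}" using ab by simp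
      then have "C u v \<le> markov_product D C u v" using ge D(1) v by blast
      then show ?thesis using D(2) by linarith
    qed
    \<comment> \<open>Convexity of the section is concavity of its negative.\<close>
    have d: "AE t in lebesgue. t \<in> {0..1} \<longrightarrow> t \<in> {0<..<1} \<and> ((\<lambda>s. - C s v) has_real_derivative - f t) (at t)"
      using f(2) by eventually_elim (auto intro: DERIV_minus)
    have b: "AE t in lebesgue. - 1 \<le> - f t \<and> - f t \<le> 0"
      using f(1) by eventually_elim auto
    obtain g where g: "antimono g" "AE t in lebesgue. t \<in> {0..1} \<longrightarrow> - f t = g t"
      by (rule AE_derivative_eq_antimono[OF four d b])
    have "mono_on {0..1} (\<lambda>t. - g t)" using g(1) by (auto simp: monotone_on_def)
    moreover have "AE t in lebesgue. t \<in> {0..1} \<longrightarrow> partial1 C t v = - g t"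
      using f(3) g(2) by eventually_elim auto
    ultimately show "\<exists>g. mono_on {0..1} g \<and> (AE t in lebesgue. t \<in> {0..1} \<longrightarrow> partial1 C t v = g t)"
      by blast
  qed
qed

end
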